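(* For every integer $p\ge0$, every real $a$ and every $\lambda>0$, $$D_3(p;a,\lambda)=\sum_{l=0}^p(-1)^{p-l}\binom pl a^{p-l}\sum_{r=0}^l\lambda^rs(l,r)=\sum_{r=0}^p\lambda^r\sum_{l=r}^p(-1)^{p-l}\binom pl a^{p-l}s(l,r).$$
   Context: $D_3(p;a,\lambda)=\sum_{n=0}^\infty\frac{(n-a)^p\lambda^n}{e^\lambda\,n!}$, which equals $\mathbf{E}(\xi-a)^p$ for $\xi$ Poisson distributed with parameter $\lambda$. The convention $0^0=1$ is used. $s(n,r)$ are the Stirling numbers of the second kind, defined by $x^n=\sum_{r=0}^ns(n,r)\,x(x-1)\cdots(x-r+1)$ (the empty product for $r=0$ being $1$). *)

theory Defs
  imports "HOL-Analysis.Analysis" "HOL-Combinatorics.Stirling"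
begin

definition D3_term :: "nat \<Rightarrow> real \<Rightarrow> real \<Rightarrow> nat \<Rightarrow> real" where
  "D3_term p a lam n = (real n - a) ^ p * lam ^ n / (exp lam * fact n)"

definition D3 :: "nat \<Rightarrow> real \<Rightarrow> real \<Rightarrow> real" where
  "D3 p a lam = (\<Sum>n. D3_term p a lam n)"

text \<open>
  The library defines \<^const>\<open>Stirling\<close> by its recurrence. The following two lemmas show that it
  agrees with the definition of the Stirling numbers of the second kind as the (unique)
  coefficients of the monomials in the basis of falling factorials.
\<close>

lemma power_eq_sum_Stirling:
  fixes x :: real
  shows "x ^ n = (\<Sum>r=0..n. real (Stirling n r) * (\<Prod>i<r. x - real i))"
proof (induction n)
  case 0
  show ?case by simp
next
  case (Suc n)
  define F where "F = (\<lambda>r. \<Prod>i<r. x - real i)"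
  have xF: "x * F r = F (Suc r) + real r * F r" for r
    by (simp add: F_def algebra_simps)
  have shift: "(\<Sum>r=0..n. real r * real (Stirling n r) * F r)
      = (\<Sum>r=0..n. real (Suc r) * real (Stirling n (Suc r)) * F (Suc r))"
  proof -
    have "(\<Sum>r=0..n. real r * real (Stirling n r) * F r)
        = (\<Sum>r=0..Suc n. real r * real (Stirling n r) * F r)"
      by simp
    also have "\<dots> = (\<Sum>r=0..n. real (Suc r) * real (Stirling n (Suc r)) * F (Suc r))"
      by (subst sum.atLeast0_atMost_Suc_shift) simp
    finally show ?thesis .
  qed
  have "x ^ Suc n = (\<Sum>r=0..n. real (Stirling n r) * (x * F r))"
    by (simp add: Suc.IH F_def sum_distrib_left mult_ac)
  also have "\<dots> = (\<Sum>r=0..n. real (Stirling n r) * F (Suc r))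
      + (\<Sum>r=0..n. real r * real (Stirling n r) * F r)"
    by (simp add: xF distrib_left sum.distrib mult_ac)
  also have "\<dots> = (\<Sum>r=0..n. real (Stirling (Suc n) (Suc r)) * F (Suc r))"
    unfolding shift sum.distrib [symmetric] by (simp add: algebra_simps)
  also have "\<dots> = (\<Sum>r=0..Suc n. real (Stirling (Suc n) r) * F r)"
    by (subst sum.atLeast0_atMost_Suc_shift) simp
  finally show ?case by (simp add: F_def)
qed

lemma Stirling_unique:
  fixes c :: "nat \<Rightarrow> real"
  assumes c: "\<And>x::real. x ^ n = (\<Sum>r=0..n. c r * (\<Prod>i<r. x - real i))"
    and "r \<le> n"
  shows "c r = real (Stirling n r)"
  using \<open>r \<le> n\<close>
proof (induction r rule: less_induct)
  case (less k)
  define d where "d = (\<lambda>r. c r - real (Stirling n r))"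
  have "(\<Sum>r=0..n. d r * (\<Prod>i<r. real k - real i)) = 0"
    using c[of "real k"] power_eq_sum_Stirling[of "real k" n]
    by (simp add: d_def left_diff_distrib sum_subtractf)
  moreover have "d r * (\<Prod>i<r. real k - real i) = 0" if "r \<le> n" "r \<noteq> k" for r
  proof (cases "r < k")
    case True
    then show ?thesis using less.IH[of r] that by (simp add: d_def)
  next
    case False
    then have "k \<in> {..<r}" using that by simp
    then have "(\<Prod>i<r. real k - real i) = 0"
      by (intro prod_zero) auto
    then show ?thesis by simp
  qed
  ultimately have "d k * (\<Prod>i<k. real k - real i) = 0"
    using less.prems by (subst (asm) sum.remove[of _ k]) (simp_all add: sum.neutral)
  then show ?case by (auto simp: d_def)
qed

end

(*
  The falling-factorial moments of the Poisson distribution are the powers of lam. Expanding a power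
  in falling factorials gives its raw moments, and the binomial theorem moves the center to a.
*)
theory Submission
  imports Defs
begin

text \<open>By induction on \<open>r\<close>: the leading factor \<open>n\<close> of the falling
  factorial cancels against \<open>fact n\<close>, and moving the index down by one releases one
  factor \<open>lam\<close>.\<close>

lemma poisson_falling_factorial_moment:
  fixes lam :: real
  shows "(\<lambda>n. (\<Prod>i<r. real n - real i) * (lam ^ n / (exp lam * fact n))) sums lam ^ r"
proof (induction r)
  case 0
  show ?case
    using sums_divide[OF exp_converges[of lam], of "exp lam"]
    by (simp add: field_simps)
next
  case (Suc r)
  let ?f = "\<lambda>r n. (\<Prod>i<r. real n - real i) * (lam ^ n / (exp lam * fact n))"
  \<comment> \<open>The factor for \<open>i = 0\<close> is split off, not the last one: the others,
    \<open>(n + 1) - (i + 1)\<close>, then form the falling factorial of \<open>n\<close>.\<close>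
  have shift: "(\<Prod>i<Suc r. real (Suc n) - real i) = real (Suc n) * (\<Prod>i<r. real n - real i)" for n
    by (simp add: prod.lessThan_Suc_shift del: prod.lessThan_Suc)
  have "?f (Suc r) (Suc n) = lam * ?f r n" for n
    unfolding shift by (simp add: divide_simps del: of_nat_Suc)
  then have "(\<lambda>n. ?f (Suc r) (Suc n)) sums (lam ^ Suc r)"
    using sums_mult[OF Suc.IH, of lam] by simp
  \<comment> \<open>The factor for \<open>i = 0\<close> vanishes at \<open>n = 0\<close>, so the
    shifted series already has the full sum.\<close>
  moreover have "?f (Suc r) 0 = 0"
    by (simp add: prod.lessThan_Suc_shift del: prod.lessThan_Suc)
  ultimately show ?case
    using sums_Suc[of "?f (Suc r)" "lam ^ Suc r"] by (simp only: add_0_right)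
qed

lemma poisson_raw_moment:
  fixes lam :: real
  shows "(\<lambda>n. real n ^ l * (lam ^ n / (exp lam * fact n))) sums
    (\<Sum>r=0..l. lam ^ r * real (Stirling l r))"
proof -
  have "(\<lambda>n. \<Sum>r=0..l. real (Stirling l r) *
      ((\<Prod>i<r. real n - real i) * (lam ^ n / (exp lam * fact n)))) sums
    (\<Sum>r=0..l. real (Stirling l r) * lam ^ r)"
    by (intro sums_sum sums_mult poisson_falling_factorial_moment)
  then show ?thesis
    by (simp only: power_eq_sum_Stirling[of "real _"] sum_distrib_left sum_distrib_right mult_ac)
qed

text \<open>Stated with \<open>sums\<close>, so that it yields both convergence and the value of the
  \<open>suminf\<close> in \<open>D3\<close>.\<close>

lemma D3_term_sums:
  "D3_term p a lam sums (\<Sum>l=0..p. (-1) ^ (p - l) * real (p choose l) * a ^ (p - l)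
      * (\<Sum>r=0..l. lam ^ r * real (Stirling l r)))"
proof -
  have "D3_term p a lam n = (\<Sum>l=0..p. (-1) ^ (p - l) * real (p choose l) * a ^ (p - l)
      * (real n ^ l * (lam ^ n / (exp lam * fact n))))" for n
  proof -
    have "(real n - a) ^ p
        = (\<Sum>l=0..p. (-1) ^ (p - l) * real (p choose l) * a ^ (p - l) * real n ^ l)"
      \<comment> \<open>The exponent \<open>p - l\<close> falls on \<open>- a\<close>, which is
        where the sign comes from. For \<open>n = 0\<close> the term \<open>l = 0\<close> relies on
        \<open>0 ^ 0 = 1\<close>.\<close>
      using binomial_ring[of "real n" "- a" p]
      by (simp add: power_minus[of a] atLeast0AtMost mult_ac)
    then show ?thesis
      by (simp add: D3_term_def sum_distrib_left sum_distrib_right sum_divide_distrib mult_ac)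
  qed
  moreover have "(\<lambda>n. \<Sum>l=0..p. (-1) ^ (p - l) * real (p choose l) * a ^ (p - l)
      * (real n ^ l * (lam ^ n / (exp lam * fact n)))) sums
    (\<Sum>l=0..p. (-1) ^ (p - l) * real (p choose l) * a ^ (p - l)
      * (\<Sum>r=0..l. lam ^ r * real (Stirling l r)))"
    by (intro sums_sum sums_mult poisson_raw_moment)
  ultimately show ?thesis
    by presburger
qed

lemma sum_triangle_swap:
  fixes g :: "nat \<Rightarrow> nat \<Rightarrow> 'a::comm_monoid_add"
  shows "(\<Sum>l=0..p. \<Sum>r=0..l. g l r) = (\<Sum>r=0..p. \<Sum>l=r..p. g l r)"
proof -
  \<comment> \<open>As a filter on the fixed range \<open>{0..p}\<close>, the dependent bound takes
    the form that \<open>sum.swap_restrict\<close> exchanges.\<close>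
  have "(\<Sum>l=0..p. \<Sum>r=0..l. g l r) = (\<Sum>l=0..p. \<Sum>r | r \<in> {0..p} \<and> r \<le> l. g l r)"
    by (intro sum.cong) auto
  also have "\<dots> = (\<Sum>r=0..p. \<Sum>l | l \<in> {0..p} \<and> r \<le> l. g l r)"
    by (rule sum.swap_restrict) auto
  also have "\<dots> = (\<Sum>r=0..p. \<Sum>l=r..p. g l r)"
    by (intro sum.cong) auto
  finally show ?thesis .
qed

theorem mainTheorem7:
  fixes p :: nat and a lam :: real
  assumes "lam > 0"
  shows "summable (D3_term p a lam)
    \<and> D3 p a lam = (\<Sum>l=0..p. (-1) ^ (p - l) * real (p choose l) * a ^ (p - l)
                      * (\<Sum>r=0..l. lam ^ r * real (Stirling l r)))
    \<and> D3 p a lam = (\<Sum>r=0..p. lam ^ r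
                      * (\<Sum>l=r..p. (-1) ^ (p - l) * real (p choose l) * a ^ (p - l)
                          * real (Stirling l r)))"
proof -
  have swap: "(\<Sum>l=0..p. (-1) ^ (p - l) * real (p choose l) * a ^ (p - l)
        * (\<Sum>r=0..l. lam ^ r * real (Stirling l r)))
      = (\<Sum>r=0..p. lam ^ r * (\<Sum>l=r..p. (-1) ^ (p - l) * real (p choose l) * a ^ (p - l)
        * real (Stirling l r)))"
    by (simp add: sum_distrib_left sum_triangle_swap mult_ac)
  show ?thesis
    \<comment> \<open>Folding the second closed form back into the first leaves a single convergence
      statement to split.\<close>
    unfolding swap[symmetric] D3_def
    using D3_term_sums[of p a lam] by (simp add: sums_iff)
qed

end
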